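(* Let $P:\mathbb C^{\mathrm{op}}\to\mathbf{Pos}$ be a primary doctrine, $X$ an object of $\mathbb C$ and $\varphi\in P(X)$, and let $P_{(X,\varphi)}$ be the associated Kleisli doctrine with canonical 1-arrow $(F_X,\mathfrak f):P\to P_{(X,\varphi)}$. If $P$ is an elementary doctrine, then $P_{(X,\varphi)}$ is an elementary doctrine, and $(F_X,\mathfrak f)$ is an elementary homomorphism.
   Context: A doctrine is a functor $P:\mathbb C^{\mathrm{op}}\to\mathbf{Pos}$ with $\mathbb C$ a category with finite products and $\mathbf{Pos}$ the category of posets and monotone maps; the maps $P(f)$ are called reindexings. It is primary if every $P(A)$ has finite meets ($\wedge$, $\top$) and all reindexings preserve them. A 1-arrow (doctrine homomorphism) from $P:\mathbb C^{\mathrm{op}}\to\mathbf{Pos}$ to $R:\mathbb D^{\mathrm{op}}\to\mathbf{Pos}$ is a pair $(F,\mathfrak f)$ with $F:\mathbb C\to\mathbb D$ a finite-product-preserving functor and $\mathfrak f:P\to R\circ F^{\mathrm{op}}$ natural; it is primary if $P,R$ are primary and each $\mathfrak f_A$ preserves finite meets. A primary doctrine $P$ is elementary if for each object $A$ there is $\delta_A\in P(A\times A)$ (the fibered equality on $A$) such that (1) $\top_A\le P(\Delta_A)(\delta_A)$; (2) $P(\mathrm{pr}_1)(\alpha)\wedge\delta_A\le P(\mathrm{pr}_2)(\alpha)$ for every $\alpha\in P(A)$, where $\mathrm{pr}_1,\mathrm{pr}_2:A\times A\to A$; (3) $P(\langle\mathrm{pr}_1,\mathrm{pr}_3\rangle)(\delta_A)\wedge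 P(\langle\mathrm{pr}_2,\mathrm{pr}_4\rangle)(\delta_B)\le\delta_{A\times B}$ in $P(A\times B\times A\times B)$ for all $A,B$. A primary homomorphism $(F,\mathfrak f)$ between elementary doctrines is elementary if $\mathfrak f_{A\times A}(\delta_A)=\delta_{FA}$ for all $A$. Kleisli doctrine (the Kleisli object of the comonad on $P$ given by $X\times-$ and $\alpha\mapsto P(\mathrm{pr}_1)(\varphi)\wedge P(\mathrm{pr}_2)(\alpha)$). The category $\mathbb C_X$ has the same objects as $\mathbb C$; an arrow $g:A\rightsquigarrow B$ in $\mathbb C_X$ is a $\mathbb C$-arrow $g:X\times A\to B$; the identity of $A$ is $\mathrm{pr}_2:X\times A\to A$; the composite of $g:A\rightsquigarrow B$ and $h:B\rightsquigarrow C$ is $h\langle\mathrm{pr}_1,g\rangle$. It has finite products, given on objects by those of $\mathbb C$. The doctrine $P_{(X,\varphi)}:\mathbb C_X^{\mathrm{op}}\to\mathbf{Pos}$ has $P_{(X,\varphi)}(A)=\{\alpha\in P(X\times A)\mid\alpha\le P(\mathrm{pr}_1)(\varphi)\}$ with the order of $P(X\times A)$, and reindexing along $g:A\rightsquigarrow B$ is the restriction of $P(\langle\mathrm{pr}_1,g\rangle)$. The 1-arrow $(F_X,\mathfrak f):P\to P_{(X,\varphi)}$: $F_X:\mathbb C\to\mathbb C_X$ is the identity on objects and sends $f:A\to B$ to $f\,\mathrm{pr}_2:A\rightsquigarrow B$; $\mathfrak f_A(\alpha)=P(\mathrm{pr}_1)(\varphi)\wedge P(\mathrm{pr}_2)(\alpha)$,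 for $\mathrm{pr}_1,\mathrm{pr}_2$ the projections from $X\times A$. *)

theory Defs
  imports "HOL-Algebra.Lattice"
begin

section \<open>Categories with finite products\<close>

record ('o, 'a) category =
  Ob :: "'o set"
  Ar :: "'a set"
  Dom :: "'a \<Rightarrow> 'o"
  Cod :: "'a \<Rightarrow> 'o"
  Ident :: "'o \<Rightarrow> 'a"
  Comp :: "'a \<Rightarrow> 'a \<Rightarrow> 'a" (infixl \<open>\<cdot>\<index>\<close> 75)

definition Hom :: "('o, 'a, 'm) category_scheme \<Rightarrow> 'o \<Rightarrow> 'o \<Rightarrow> 'a set" where
  "Hom C A B = {f \<in> Ar C. Dom C f = A \<and> Cod C f = B}"

locale category = fixes C :: "('o, 'a, 'm) category_scheme" (structure)
  assumes dom_in: "f \<in> Ar C \<Longrightarrow> Dom C f \<in> Ob C"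
    and cod_in: "f \<in> Ar C \<Longrightarrow> Cod C f \<in> Ob C"
    and ident_in: "A \<in> Ob C \<Longrightarrow> Ident C A \<in> Hom C A A"
    and comp_in: "f \<in> Hom C A B \<Longrightarrow> g \<in> Hom C B D \<Longrightarrow> g \<cdot> f \<in> Hom C A D"
    and comp_ident: "f \<in> Hom C A B \<Longrightarrow> f \<cdot> Ident C A = f"
    and ident_comp: "f \<in> Hom C A B \<Longrightarrow> Ident C B \<cdot> f = f"
    and comp_assoc:
      "f \<in> Hom C A B \<Longrightarrow> g \<in> Hom C B D \<Longrightarrow> h \<in> Hom C D E \<Longrightarrow> h \<cdot> (g \<cdot> f) = h \<cdot> g \<cdot> f"

definition is_terminal :: "('o, 'a, 'm) category_scheme \<Rightarrow> 'o \<Rightarrow> bool" where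
  "is_terminal C T \<longleftrightarrow> T \<in> Ob C \<and> (\<forall>A \<in> Ob C. \<exists>!f. f \<in> Hom C A T)"

definition is_product ::
  "('o, 'a, 'm) category_scheme \<Rightarrow> 'o \<Rightarrow> 'o \<Rightarrow> 'o \<Rightarrow> 'a \<Rightarrow> 'a \<Rightarrow> bool" where
  "is_product C A B V p q \<longleftrightarrow> p \<in> Hom C V A \<and> q \<in> Hom C V B \<and>
     (\<forall>Z \<in> Ob C. \<forall>f \<in> Hom C Z A. \<forall>g \<in> Hom C Z B.
        \<exists>!h. h \<in> Hom C Z V \<and> p \<cdot>\<^bsub>C\<^esub> h = f \<and> q \<cdot>\<^bsub>C\<^esub> h = g)"

text \<open>Finite products are a choice of a terminal object and of binary products, so that
  expressions such as \<open>P(A \<times> A)\<close> denote.\<close>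

record ('o, 'a) fp_category = "('o, 'a) category" +
  One :: 'o
  Prod :: "'o \<Rightarrow> 'o \<Rightarrow> 'o"
  Pr1 :: "'o \<Rightarrow> 'o \<Rightarrow> 'a"
  Pr2 :: "'o \<Rightarrow> 'o \<Rightarrow> 'a"

locale fp_category = category C for C :: "('o, 'a, 'm) fp_category_scheme" (structure) +
  assumes terminal: "is_terminal C (One C)"
    and products:
      "A \<in> Ob C \<Longrightarrow> B \<in> Ob C \<Longrightarrow> is_product C A B (Prod C A B) (Pr1 C A B) (Pr2 C A B)"

definition pair :: "('o, 'a, 'm) fp_category_scheme \<Rightarrow> 'a \<Rightarrow> 'a \<Rightarrow> 'a"
    (\<open>\<langle>_,/ _\<rangle>\<index>\<close>) where
  "\<langle>f, g\<rangle>\<^bsub>C\<^esub> = (THE h. h \<in> Hom C (Dom C f) (Prod C (Cod C f) (Cod C g)) \<and>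
     Pr1 C (Cod C f) (Cod C g) \<cdot>\<^bsub>C\<^esub> h = f \<and> Pr2 C (Cod C f) (Cod C g) \<cdot>\<^bsub>C\<^esub> h = g)"


section \<open>Doctrines\<close>

record ('o, 'a, 'p) doctrine =
  base :: "('o, 'a) fp_category"
  fibre :: "'o \<Rightarrow> 'p gorder"
  reindex :: "'a \<Rightarrow> 'p \<Rightarrow> 'p"

locale doctrine = fixes P :: "('o, 'a, 'p) doctrine"
  assumes base_fp: "fp_category (base P)"
    and fibre_poset: "A \<in> Ob (base P) \<Longrightarrow> partial_order (fibre P A)"
    and reindex_in: "f \<in> Hom (base P) A B \<Longrightarrow>
      reindex P f \<in> carrier (fibre P B) \<rightarrow> carrier (fibre P A)"
    and reindex_mono: "f \<in> Hom (base P) A B \<Longrightarrow>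
      isotone (fibre P B) (fibre P A) (reindex P f)"
    and reindex_ident: "A \<in> Ob (base P) \<Longrightarrow> \<alpha> \<in> carrier (fibre P A) \<Longrightarrow>
      reindex P (Ident (base P) A) \<alpha> = \<alpha>"
    and reindex_comp: "f \<in> Hom (base P) A B \<Longrightarrow> g \<in> Hom (base P) B D \<Longrightarrow>
      \<alpha> \<in> carrier (fibre P D) \<Longrightarrow>
      reindex P (g \<cdot>\<^bsub>base P\<^esub> f) \<alpha> = reindex P f (reindex P g \<alpha>)"

definition preserves_finite_meets :: "'p gorder \<Rightarrow> 'q gorder \<Rightarrow> ('p \<Rightarrow> 'q) \<Rightarrow> bool" where
  "preserves_finite_meets L M h \<longleftrightarrow> h \<top>\<^bsub>L\<^esub> = \<top>\<^bsub>M\<^esub> \<and>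
     (\<forall>x \<in> carrier L. \<forall>y \<in> carrier L. h (x \<sqinter>\<^bsub>L\<^esub> y) = h x \<sqinter>\<^bsub>M\<^esub> h y)"

locale primary_doctrine = doctrine P for P :: "('o, 'a, 'p) doctrine" +
  assumes fibre_meets: "A \<in> Ob (base P) \<Longrightarrow> lower_semilattice (fibre P A)"
    and fibre_top: "A \<in> Ob (base P) \<Longrightarrow> weak_partial_order_top (fibre P A)"
    and reindex_meets: "f \<in> Hom (base P) A B \<Longrightarrow>
      preserves_finite_meets (fibre P B) (fibre P A) (reindex P f)"

text \<open>The product \<open>A \<times> B \<times> A \<times> B\<close> is bracketed as \<open>(A \<times> B) \<times> (A \<times> B)\<close>, as needed for
  \<open>\<delta>\<^bsub>A \<times> B\<^esub>\<close>; its four projections are then the composites \<open>pr1\<close> to \<open>pr4\<close> below.\<close>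

definition fibered_equality :: "('o, 'a, 'p) doctrine \<Rightarrow> ('o \<Rightarrow> 'p) \<Rightarrow> bool" where
  "fibered_equality P \<delta> \<longleftrightarrow> (let C = base P in
     (\<forall>A \<in> Ob C. \<delta> A \<in> carrier (fibre P (Prod C A A))) \<and>
     (\<forall>A \<in> Ob C.
        \<top>\<^bsub>fibre P A\<^esub> \<sqsubseteq>\<^bsub>fibre P A\<^esub> reindex P \<langle>Ident C A, Ident C A\<rangle>\<^bsub>C\<^esub> (\<delta> A)) \<and>
     (\<forall>A \<in> Ob C. \<forall>\<alpha> \<in> carrier (fibre P A).
        reindex P (Pr1 C A A) \<alpha> \<sqinter>\<^bsub>fibre P (Prod C A A)\<^esub> \<delta> A
          \<sqsubseteq>\<^bsub>fibre P (Prod C A A)\<^esub> reindex P (Pr2 C A A) \<alpha>) \<and>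
     (\<forall>A \<in> Ob C. \<forall>B \<in> Ob C.
        let AB = Prod C A B;
            ABAB = Prod C AB AB;
            pr1 = Pr1 C A B \<cdot>\<^bsub>C\<^esub> Pr1 C AB AB;
            pr2 = Pr2 C A B \<cdot>\<^bsub>C\<^esub> Pr1 C AB AB;
            pr3 = Pr1 C A B \<cdot>\<^bsub>C\<^esub> Pr2 C AB AB;
            pr4 = Pr2 C A B \<cdot>\<^bsub>C\<^esub> Pr2 C AB AB
        in reindex P \<langle>pr1, pr3\<rangle>\<^bsub>C\<^esub> (\<delta> A) \<sqinter>\<^bsub>fibre P ABAB\<^esub> reindex P \<langle>pr2, pr4\<rangle>\<^bsub>C\<^esub> (\<delta> B)
             \<sqsubseteq>\<^bsub>fibre P ABAB\<^esub> \<delta> AB))"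

locale elementary_doctrine = primary_doctrine P for P :: "('o, 'a, 'p) doctrine" +
  assumes ex_fibered_equality: "\<exists>\<delta>. fibered_equality P \<delta>"


section \<open>Doctrine homomorphisms\<close>

record ('o, 'a, 'p, 'o2, 'a2, 'p2) doctrine_arrow =
  on_ob :: "'o \<Rightarrow> 'o2"
  on_ar :: "'a \<Rightarrow> 'a2"
  on_fibre :: "'o \<Rightarrow> 'p \<Rightarrow> 'p2"

locale fp_functor =
  fixes C :: "('o, 'a) fp_category" and D :: "('o2, 'a2) fp_category"
    and F0 :: "'o \<Rightarrow> 'o2" and F1 :: "'a \<Rightarrow> 'a2"
  assumes ob_in: "A \<in> Ob C \<Longrightarrow> F0 A \<in> Ob D"
    and ar_in: "f \<in> Hom C A B \<Longrightarrow> F1 f \<in> Hom D (F0 A) (F0 B)"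
    and map_ident: "A \<in> Ob C \<Longrightarrow> F1 (Ident C A) = Ident D (F0 A)"
    and map_comp: "f \<in> Hom C A B \<Longrightarrow> g \<in> Hom C B E \<Longrightarrow>
      F1 (g \<cdot>\<^bsub>C\<^esub> f) = F1 g \<cdot>\<^bsub>D\<^esub> F1 f"
    and map_terminal: "is_terminal D (F0 (One C))"
    and map_product: "A \<in> Ob C \<Longrightarrow> B \<in> Ob C \<Longrightarrow>
      is_product D (F0 A) (F0 B) (F0 (Prod C A B)) (F1 (Pr1 C A B)) (F1 (Pr2 C A B))"

locale doctrine_hom =
  fixes P :: "('o, 'a, 'p) doctrine" and R :: "('o2, 'a2, 'p2) doctrine"
    and H :: "('o, 'a, 'p, 'o2, 'a2, 'p2) doctrine_arrow"
  assumes source: "doctrine P"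
    and target: "doctrine R"
    and functor_part: "fp_functor (base P) (base R) (on_ob H) (on_ar H)"
    and on_fibre_in: "A \<in> Ob (base P) \<Longrightarrow>
      on_fibre H A \<in> carrier (fibre P A) \<rightarrow> carrier (fibre R (on_ob H A))"
    and on_fibre_mono: "A \<in> Ob (base P) \<Longrightarrow>
      isotone (fibre P A) (fibre R (on_ob H A)) (on_fibre H A)"
    and natural: "f \<in> Hom (base P) A B \<Longrightarrow> \<beta> \<in> carrier (fibre P B) \<Longrightarrow>
      on_fibre H A (reindex P f \<beta>) = reindex R (on_ar H f) (on_fibre H B \<beta>)"

locale primary_hom = doctrine_hom P R H
  for P :: "('o, 'a, 'p) doctrine" and R :: "('o2, 'a2, 'p2) doctrine"
    and H :: "('o, 'a, 'p, 'o2, 'a2, 'p2) doctrine_arrow" +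
  assumes source_primary: "primary_doctrine P"
    and target_primary: "primary_doctrine R"
    and on_fibre_meets: "A \<in> Ob (base P) \<Longrightarrow>
      preserves_finite_meets (fibre P A) (fibre R (on_ob H A)) (on_fibre H A)"

text \<open>A finite-product-preserving functor preserves products only up to the canonical
  isomorphism \<open>\<langle>F pr1, F pr2\<rangle> : F(A \<times> A) \<rightarrow> FA \<times> FA\<close>, so \<open>\<delta>\<^bsub>FA\<^esub>\<close> has to be reindexed along it
  before it can be compared with the image of \<open>\<delta>\<^bsub>A\<^esub>\<close>; if \<open>F\<close> preserves the chosen products
  strictly, that isomorphism is an identity. Fibered equalities are unique, so quantifying
  over all of them just names those of \<open>P\<close> and \<open>R\<close>, which exist by the first two
  assumptions.\<close>

locale elementary_hom = primary_hom P R H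
  for P :: "('o, 'a, 'p) doctrine" and R :: "('o2, 'a2, 'p2) doctrine"
    and H :: "('o, 'a, 'p, 'o2, 'a2, 'p2) doctrine_arrow" +
  assumes source_elementary: "elementary_doctrine P"
    and target_elementary: "elementary_doctrine R"
    and on_fibre_equality: "fibered_equality P \<delta> \<Longrightarrow> fibered_equality R \<epsilon> \<Longrightarrow>
      A \<in> Ob (base P) \<Longrightarrow>
      on_fibre H (Prod (base P) A A) (\<delta> A) =
        reindex R \<langle>on_ar H (Pr1 (base P) A A), on_ar H (Pr2 (base P) A A)\<rangle>\<^bsub>base R\<^esub>
          (\<epsilon> (on_ob H A))"


section \<open>The Kleisli doctrine\<close>

text \<open>An arrow \<open>A \<leadsto> B\<close> is an arrow \<open>g : X \<times> A \<rightarrow> B\<close> tagged with its domain \<open>A\<close>, which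
  \<open>g\<close> alone does not determine because \<open>Prod C X\<close> need not be injective. The projections
  (and the terminal object) are the images of those of \<open>C\<close> under \<open>F\<^sub>X\<close>.\<close>

definition kleisli_functor_ar :: "('o, 'a) fp_category \<Rightarrow> 'o \<Rightarrow> 'a \<Rightarrow> 'o \<times> 'a" where
  "kleisli_functor_ar C X f = (Dom C f, f \<cdot>\<^bsub>C\<^esub> Pr2 C X (Dom C f))"

definition kleisli_category :: "('o, 'a) fp_category \<Rightarrow> 'o \<Rightarrow> ('o, 'o \<times> 'a) fp_category" where
  "kleisli_category C X = \<lparr>
     Ob = Ob C,
     Ar = {(A, g). A \<in> Ob C \<and> g \<in> Ar C \<and> Dom C g = Prod C X A},
     Dom = (\<lambda>(A, g). A),
     Cod = (\<lambda>(A, g). Cod C g),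
     Ident = (\<lambda>A. (A, Pr2 C X A)),
     Comp = (\<lambda>(B, h) (A, g). (A, h \<cdot>\<^bsub>C\<^esub> \<langle>Pr1 C X A, g\<rangle>\<^bsub>C\<^esub>)),
     One = One C,
     Prod = Prod C,
     Pr1 = (\<lambda>A B. kleisli_functor_ar C X (Pr1 C A B)),
     Pr2 = (\<lambda>A B. kleisli_functor_ar C X (Pr2 C A B))\<rparr>"

definition kleisli_doctrine ::
  "('o, 'a, 'p) doctrine \<Rightarrow> 'o \<Rightarrow> 'p \<Rightarrow> ('o, 'o \<times> 'a, 'p) doctrine" where
  "kleisli_doctrine P X \<phi> = (let C = base P in \<lparr>
     base = kleisli_category C X,
     fibre = (\<lambda>A. let L = fibre P (Prod C X A) in
       L\<lparr>carrier := {\<alpha> \<in> carrier L. \<alpha> \<sqsubseteq>\<^bsub>L\<^esub> reindex P (Pr1 C X A) \<phi>}\<rparr>),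
     reindex = (\<lambda>(A, g). reindex P \<langle>Pr1 C X A, g\<rangle>\<^bsub>C\<^esub>)\<rparr>)"

definition kleisli_arrow ::
  "('o, 'a, 'p) doctrine \<Rightarrow> 'o \<Rightarrow> 'p \<Rightarrow> ('o, 'a, 'p, 'o, 'o \<times> 'a, 'p) doctrine_arrow" where
  "kleisli_arrow P X \<phi> = (let C = base P in \<lparr>
     on_ob = (\<lambda>A. A),
     on_ar = kleisli_functor_ar C X,
     on_fibre = (\<lambda>A \<alpha>. reindex P (Pr1 C X A) \<phi> \<sqinter>\<^bsub>fibre P (Prod C X A)\<^esub> reindex P (Pr2 C X A) \<alpha>)\<rparr>)"

end

theory Submission
  imports Defs
begin

text \<open>The fibered equality of the Kleisli doctrine on \<open>A\<close> is the image of \<open>\<delta>\<^bsub>A\<^esub>\<close> under the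
  canonical arrow \<open>\<ff>\<close>, namely \<open>P(pr\<^sub>1)(\<phi>) \<and> P(pr\<^sub>2)(\<delta>\<^bsub>A\<^esub>)\<close>. Its reflexivity and its
  compatibility with products are the images under \<open>\<ff>\<close> of those of \<open>\<delta>\<close>, because \<open>F\<^sub>X\<close>
  strictly preserves the chosen products and \<open>\<ff>\<close> is natural and preserves finite meets. Its
  substitutivity is substitutivity in \<open>P\<close> with a parameter in \<open>X\<close>, which follows from the
  substitutivity of \<open>\<delta>\<^bsub>X \<times> A\<^esub>\<close> and the bound \<open>\<delta>\<^bsub>X\<^esub> \<and> \<delta>\<^bsub>A\<^esub> \<le> \<delta>\<^bsub>X \<times> A\<^esub>\<close>.
  Substitution with a parameter also gives uniqueness of fibered equalities, hence the canonical
  arrow preserves them.\<close>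

section \<open>Calculating in categories with finite products\<close>

text \<open>The axioms are restated in terms of domains and codomains: typing conditions such as
  \<open>f \<in> Hom C A B\<close> contain objects that the simplifier could not guess.\<close>

context category
begin

lemma Hom_iff [simp]: "f \<in> Hom C A B \<longleftrightarrow> f \<in> Ar C \<and> Dom C f = A \<and> Cod C f = B"
  by (simp add: Hom_def)

declare dom_in [simp] cod_in [simp]

lemma ident_arrow [simp]:
  assumes "A \<in> Ob C"
  shows "Ident C A \<in> Ar C" "Dom C (Ident C A) = A" "Cod C (Ident C A) = A"
  using ident_in [OF assms] by simp_all

lemma comp_arrow [simp]:
  assumes "f \<in> Ar C" "g \<in> Ar C" "Cod C f = Dom C g"
  shows "g \<cdot> f \<in> Ar C" "Dom C (g \<cdot> f) = Dom C f" "Cod C (g \<cdot> f) = Cod C g"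
  using comp_in [of f "Dom C f" "Dom C g" g "Cod C g"] assms by simp_all

lemma comp_ident' [simp]: "f \<in> Ar C \<Longrightarrow> Dom C f = A \<Longrightarrow> f \<cdot> Ident C A = f"
  using comp_ident by auto

lemma ident_comp' [simp]: "f \<in> Ar C \<Longrightarrow> Cod C f = A \<Longrightarrow> Ident C A \<cdot> f = f"
  using ident_comp by auto

lemma comp_assoc' [simp]:
  assumes "f \<in> Ar C" "g \<in> Ar C" "h \<in> Ar C" "Cod C f = Dom C g" "Cod C g = Dom C h"
  shows "h \<cdot> g \<cdot> f = h \<cdot> (g \<cdot> f)"
  using comp_assoc [of f "Dom C f" "Cod C f" g "Cod C g" h "Cod C h"] assms by simp

end

context fp_category
begin

text \<open>That the chosen product is an object is not an axiom by itself; it is the domain of the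
  arrow \<open>Pr1 C A B\<close>.\<close>

lemma Prod_in [simp]: "A \<in> Ob C \<Longrightarrow> B \<in> Ob C \<Longrightarrow> Prod C A B \<in> Ob C"
  and Pr1_arrow [simp]: "A \<in> Ob C \<Longrightarrow> B \<in> Ob C \<Longrightarrow> Pr1 C A B \<in> Ar C"
    "A \<in> Ob C \<Longrightarrow> B \<in> Ob C \<Longrightarrow> Dom C (Pr1 C A B) = Prod C A B"
    "A \<in> Ob C \<Longrightarrow> B \<in> Ob C \<Longrightarrow> Cod C (Pr1 C A B) = A"
  and Pr2_arrow [simp]: "A \<in> Ob C \<Longrightarrow> B \<in> Ob C \<Longrightarrow> Pr2 C A B \<in> Ar C"
    "A \<in> Ob C \<Longrightarrow> B \<in> Ob C \<Longrightarrow> Dom C (Pr2 C A B) = Prod C A B"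
    "A \<in> Ob C \<Longrightarrow> B \<in> Ob C \<Longrightarrow> Cod C (Pr2 C A B) = B"
  using products [of A B] dom_in [of "Pr1 C A B"] by (auto simp: is_product_def)

text \<open>Justifies the definite description in \<open>pair\<close>, so that the typing and
  projection equations below can be read off it.\<close>

lemma pair_ex1:
  assumes "f \<in> Ar C" "g \<in> Ar C" "Dom C f = Dom C g"
  shows "\<exists>!h. h \<in> Hom C (Dom C f) (Prod C (Cod C f) (Cod C g)) \<and>
    Pr1 C (Cod C f) (Cod C g) \<cdot> h = f \<and> Pr2 C (Cod C f) (Cod C g) \<cdot> h = g"
  using products [of "Cod C f" "Cod C g"] assms unfolding is_product_def
  by (auto dest!: bspec [of _ _ "Dom C f"] bspec [of _ _ f] bspec [of _ _ g])

lemma pair_arrow [simp]: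
  assumes "f \<in> Ar C" "g \<in> Ar C" "Dom C f = Dom C g"
  shows "\<langle>f, g\<rangle> \<in> Ar C" "Dom C \<langle>f, g\<rangle> = Dom C f" "Cod C \<langle>f, g\<rangle> = Prod C (Cod C f) (Cod C g)"
  using theI' [OF pair_ex1 [OF assms]] unfolding pair_def by simp_all

lemma Pr1_pair [simp]:
  assumes "f \<in> Ar C" "g \<in> Ar C" "Dom C f = Dom C g" "Cod C f = A" "Cod C g = B"
  shows "Pr1 C A B \<cdot> \<langle>f, g\<rangle> = f"
  using theI' [OF pair_ex1 [OF assms(1-3)]] assms(4-5) unfolding pair_def by simp

lemma Pr2_pair [simp]:
  assumes "f \<in> Ar C" "g \<in> Ar C" "Dom C f = Dom C g" "Cod C f = A" "Cod C g = B"
  shows "Pr2 C A B \<cdot> \<langle>f, g\<rangle> = g"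
  using theI' [OF pair_ex1 [OF assms(1-3)]] assms(4-5) unfolding pair_def by simp

text \<open>The uniqueness half of the universal property as an eta rule: an arrow into a product is
  recognised by computing its two components.\<close>

lemma pair_unique:
  assumes "h \<in> Ar C" "Cod C h = Prod C A B" "A \<in> Ob C" "B \<in> Ob C"
  shows "\<langle>Pr1 C A B \<cdot> h, Pr2 C A B \<cdot> h\<rangle> = h"
  unfolding pair_def using pair_ex1 [of "Pr1 C A B \<cdot> h" "Pr2 C A B \<cdot> h"] assms
  by (intro the1_equality) simp_all

lemma pair_Pr [simp]:
  "A \<in> Ob C \<Longrightarrow> B \<in> Ob C \<Longrightarrow> \<langle>Pr1 C A B, Pr2 C A B\<rangle> = Ident C (Prod C A B)"
  using pair_unique [of "Ident C (Prod C A B)" A B] by simp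

lemma pair_comp [simp]:
  assumes "f \<in> Ar C" "g \<in> Ar C" "Dom C f = Dom C g" "k \<in> Ar C" "Cod C k = Dom C f"
  shows "\<langle>f, g\<rangle> \<cdot> k = \<langle>f \<cdot> k, g \<cdot> k\<rangle>"
proof -
  \<comment> \<open>Right-nested bracketing hides the projection of a pair; the two instances of
    associativity bring \<open>Pr1\<close> and \<open>Pr2\<close> next to the pair.\<close>
  have "Pr1 C (Cod C f) (Cod C g) \<cdot> (\<langle>f, g\<rangle> \<cdot> k) = f \<cdot> k"
    "Pr2 C (Cod C f) (Cod C g) \<cdot> (\<langle>f, g\<rangle> \<cdot> k) = g \<cdot> k"
    using assms comp_assoc' [of k "\<langle>f, g\<rangle>" "Pr1 C (Cod C f) (Cod C g)"]
      comp_assoc' [of k "\<langle>f, g\<rangle>" "Pr2 C (Cod C f) (Cod C g)"]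
    by simp_all
  then show ?thesis
    using pair_unique [of "\<langle>f, g\<rangle> \<cdot> k" "Cod C f" "Cod C g"] assms by simp
qed

end

section \<open>Meets in semilattices and in principal down-sets\<close>

lemma (in lower_semilattice) meet_le_left:
  "x \<sqsubseteq> z \<Longrightarrow> x \<in> carrier L \<Longrightarrow> y \<in> carrier L \<Longrightarrow> z \<in> carrier L \<Longrightarrow> x \<sqinter> y \<sqsubseteq> z"
  by (rule le_trans [OF meet_left]) simp_all

lemma (in lower_semilattice) meet_le_right:
  "y \<sqsubseteq> z \<Longrightarrow> x \<in> carrier L \<Longrightarrow> y \<in> carrier L \<Longrightarrow> z \<in> carrier L \<Longrightarrow> x \<sqinter> y \<sqsubseteq> z"
  by (rule le_trans [OF meet_right]) simp_all

text \<open>Idempotence of meets lets \<open>x\<close> be duplicated. With \<open>x\<close> the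
  predicate \<phi> pulled back to X \<times> A, this is why \<ff> preserves binary meets.\<close>

lemma (in lower_semilattice) meet_distrib_meet:
  assumes [simp]: "x \<in> carrier L" "y \<in> carrier L" "z \<in> carrier L"
  shows "x \<sqinter> (y \<sqinter> z) = (x \<sqinter> y) \<sqinter> (x \<sqinter> z)"
proof (rule le_antisym)
  show "x \<sqinter> (y \<sqinter> z) \<sqsubseteq> (x \<sqinter> y) \<sqinter> (x \<sqinter> z)"
    by (intro meet_le) (simp_all add: meet_left meet_right meet_le_right)
  show "(x \<sqinter> y) \<sqinter> (x \<sqinter> z) \<sqsubseteq> x \<sqinter> (y \<sqinter> z)"
    by (intro meet_le) (simp_all add: meet_left meet_right meet_le_left meet_le_right)
qed simp_all

text \<open>A down-set is closed under meets with its members, so greatest lower bounds are those of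
  \<open>L\<close>, while the generator \<open>t\<close> becomes the top. Each fibre of the Kleisli
  doctrine has this form.\<close>

lemma (in lower_semilattice) principal_down_set:
  fixes t
  defines "D \<equiv> L\<lparr>carrier := {x \<in> carrier L. x \<sqsubseteq> t}\<rparr>"
  assumes t: "t \<in> carrier L"
  shows "lower_semilattice D" "weak_partial_order_top D" "\<top>\<^bsub>D\<^esub> = t"
    and "x \<in> carrier D \<Longrightarrow> y \<in> carrier D \<Longrightarrow> x \<sqinter>\<^bsub>D\<^esub> y = x \<sqinter> y"
proof -
  have D: "carrier D = {x \<in> carrier L. x \<sqsubseteq> t}" "le D = le L"
    by (simp_all add: D_def)
  interpret D: weak_partial_order D
    unfolding D_def by (rule weak_partial_order_subset) (auto intro: weak_partial_order_axioms)
  interpret D: partial_order D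
    by unfold_locales (simp add: D_def eq_is_equal)
  have glb: "greatest D (x \<sqinter> y) (Lower D {x, y})" if "x \<in> carrier D" "y \<in> carrier D" for x y
    using that t D
    by (intro greatest_LowerI)
      (auto simp: Lower_def intro: meet_left meet_right meet_le le_trans [of _ x])
  show "lower_semilattice D"
    by unfold_locales (use glb in blast)
  then interpret D: lower_semilattice D .
  \<comment> \<open>The meet of \<open>D\<close> is defined as some greatest lower bound in
    \<open>D\<close>; uniqueness identifies it with the one inherited from \<open>L\<close>. The top
    is treated likewise.\<close>
  show "x \<sqinter>\<^bsub>D\<^esub> y = x \<sqinter> y" if "x \<in> carrier D" "y \<in> carrier D"
    using D.greatest_unique [OF _ glb [OF that]] D.inf_of_two_greatest [OF that]
    by (simp add: meet_def)
  have top: "greatest D t (carrier D)"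
    using t D by (auto simp: greatest_def)
  show "weak_partial_order_top D"
    by unfold_locales (use top in blast)
  then interpret D: weak_partial_order_top D .
  show "\<top>\<^bsub>D\<^esub> = t"
    using D.greatest_unique [OF D.top_greatest top] .
qed

section \<open>Fibered equality in primary doctrines\<close>

sublocale doctrine \<subseteq> base: fp_category "base P"
  by (rule base_fp)

context primary_doctrine
begin

lemma reindex_closed [simp]:
  "f \<in> Ar (base P) \<Longrightarrow> Dom (base P) f = A \<Longrightarrow> \<alpha> \<in> carrier (fibre P (Cod (base P) f)) \<Longrightarrow>
    reindex P f \<alpha> \<in> carrier (fibre P A)"
  using reindex_in [of f A "Cod (base P) f"] by auto

lemma reindex_le:
  "f \<in> Ar (base P) \<Longrightarrow> Dom (base P) f = A \<Longrightarrow> Cod (base P) f = B \<Longrightarrow> \<alpha> \<sqsubseteq>\<^bsub>fibre P B\<^esub> \<beta> \<Longrightarrow>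
    \<alpha> \<in> carrier (fibre P B) \<Longrightarrow> \<beta> \<in> carrier (fibre P B) \<Longrightarrow>
    reindex P f \<alpha> \<sqsubseteq>\<^bsub>fibre P A\<^esub> reindex P f \<beta>"
  using reindex_mono [of f A B] by (auto simp: isotone_def)

lemma reindex_reindex [simp]:
  "f \<in> Ar (base P) \<Longrightarrow> g \<in> Ar (base P) \<Longrightarrow> Cod (base P) f = Dom (base P) g \<Longrightarrow>
    \<alpha> \<in> carrier (fibre P (Cod (base P) g)) \<Longrightarrow>
    reindex P f (reindex P g \<alpha>) = reindex P (g \<cdot>\<^bsub>base P\<^esub> f) \<alpha>"
  using reindex_comp [of f "Dom (base P) f" "Cod (base P) f" g] by simp

lemma reindex_meet [simp]:
  "f \<in> Ar (base P) \<Longrightarrow> Cod (base P) f = B \<Longrightarrow>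
    \<alpha> \<in> carrier (fibre P B) \<Longrightarrow> \<beta> \<in> carrier (fibre P B) \<Longrightarrow>
    reindex P f (\<alpha> \<sqinter>\<^bsub>fibre P B\<^esub> \<beta>) = reindex P f \<alpha> \<sqinter>\<^bsub>fibre P (Dom (base P) f)\<^esub> reindex P f \<beta>"
  using reindex_meets [of f "Dom (base P) f" "Cod (base P) f"]
  by (auto simp: preserves_finite_meets_def)

lemma reindex_top [simp]:
  "f \<in> Ar (base P) \<Longrightarrow> Cod (base P) f = B \<Longrightarrow>
    reindex P f \<top>\<^bsub>fibre P B\<^esub> = \<top>\<^bsub>fibre P (Dom (base P) f)\<^esub>"
  using reindex_meets [of f "Dom (base P) f" "Cod (base P) f"]
  by (auto simp: preserves_finite_meets_def)

lemma meet_in_fibre [simp]: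
  "A \<in> Ob (base P) \<Longrightarrow> \<alpha> \<in> carrier (fibre P A) \<Longrightarrow> \<beta> \<in> carrier (fibre P A) \<Longrightarrow>
    \<alpha> \<sqinter>\<^bsub>fibre P A\<^esub> \<beta> \<in> carrier (fibre P A)"
proof -
  assume "A \<in> Ob (base P)" and \<alpha>\<beta>: "\<alpha> \<in> carrier (fibre P A)" "\<beta> \<in> carrier (fibre P A)"
  then interpret L: lower_semilattice "fibre P A"
    by (intro fibre_meets)
  show ?thesis
    using \<alpha>\<beta> by simp
qed

lemma top_in_fibre [simp]: "A \<in> Ob (base P) \<Longrightarrow> \<top>\<^bsub>fibre P A\<^esub> \<in> carrier (fibre P A)"
  using fibre_top weak_partial_order_top.top_closed by blast

lemma fibered_equality_closed:
  "fibered_equality P \<delta> \<Longrightarrow> A \<in> Ob (base P) \<Longrightarrow>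
    \<delta> A \<in> carrier (fibre P (Prod (base P) A A))"
  by (simp add: fibered_equality_def Let_def)

text \<open>Reflexivity at a generalised element \<open>f\<close> of \<open>A\<close>: reindexing
  along \<open>f\<close> preserves \<top> and turns the diagonal into the pair of \<open>f\<close>
  with itself, and every \<gamma> lies below \<top>.\<close>

lemma fibered_equality_refl:
  assumes "fibered_equality P \<delta>" "f \<in> Ar (base P)" "Dom (base P) f = Z" "Cod (base P) f = A"
    "\<gamma> \<in> carrier (fibre P Z)"
  shows "\<gamma> \<sqsubseteq>\<^bsub>fibre P Z\<^esub> reindex P \<langle>f, f\<rangle>\<^bsub>base P\<^esub> (\<delta> A)"
proof -
  note [simp] = fibered_equality_closed [OF assms(1)]
  have ob: "Z \<in> Ob (base P)" "A \<in> Ob (base P)"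
    using assms by auto
  interpret L: weak_partial_order_top "fibre P Z"
    by (rule fibre_top [OF ob(1)])
  have "\<gamma> \<sqsubseteq>\<^bsub>fibre P Z\<^esub> \<top>\<^bsub>fibre P Z\<^esub>"
    using assms by simp
  have "\<top>\<^bsub>fibre P A\<^esub> \<sqsubseteq>\<^bsub>fibre P A\<^esub> reindex P \<langle>Ident (base P) A, Ident (base P) A\<rangle>\<^bsub>base P\<^esub> (\<delta> A)"
    using assms(1) ob by (simp add: fibered_equality_def Let_def)
  from reindex_le [OF assms(2-4) this]
  have "\<top>\<^bsub>fibre P Z\<^esub> \<sqsubseteq>\<^bsub>fibre P Z\<^esub> reindex P \<langle>f, f\<rangle>\<^bsub>base P\<^esub> (\<delta> A)"
    using assms ob by simp
  with \<open>\<gamma> \<sqsubseteq>\<^bsub>fibre P Z\<^esub> \<top>\<^bsub>fibre P Z\<^esub>\<close> show ?thesis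
    by (rule L.le_trans) (use assms ob in simp_all)
qed

text \<open>Here \<open>x\<close>, \<open>a\<close>, \<open>b\<close> are generalised elements over
  the context \<open>Z\<close>. From x = x and a = b follows (x, a) = (x, b) in X \<times> A, and
  substitutivity there transports \<alpha>.\<close>

lemma fibered_equality_subst:
  assumes \<delta>: "fibered_equality P \<delta>"
    and arr: "x \<in> Ar (base P)" "a \<in> Ar (base P)" "b \<in> Ar (base P)"
    and dom: "Dom (base P) x = Z" "Dom (base P) a = Z" "Dom (base P) b = Z"
    and cod: "Cod (base P) x = X" "Cod (base P) a = A" "Cod (base P) b = A"
    and \<alpha>: "\<alpha> \<in> carrier (fibre P (Prod (base P) X A))"
  shows "reindex P \<langle>x, a\<rangle>\<^bsub>base P\<^esub> \<alpha> \<sqinter>\<^bsub>fibre P Z\<^esub> reindex P \<langle>a, b\<rangle>\<^bsub>base P\<^esub> (\<delta> A)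
    \<sqsubseteq>\<^bsub>fibre P Z\<^esub> reindex P \<langle>x, b\<rangle>\<^bsub>base P\<^esub> \<alpha>"
proof -
  note [simp] = fibered_equality_closed [OF \<delta>]
  let ?C = "base P"
  let ?W = "Prod ?C X A"
  let ?k = "\<langle>\<langle>x, a\<rangle>\<^bsub>?C\<^esub>, \<langle>x, b\<rangle>\<^bsub>?C\<^esub>\<rangle>\<^bsub>?C\<^esub>"
  have ob: "Z \<in> Ob ?C" "X \<in> Ob ?C" "A \<in> Ob ?C"
    using arr dom cod by auto
  interpret L: lower_semilattice "fibre P Z"
    by (rule fibre_meets [OF ob(1)])
  \<comment> \<open>\<open>?k\<close> names the two elements (x, a) and (x, b) of \<open>?W\<close>;
    the axioms for \<delta> at \<open>?W\<close> are pulled back along it.\<close>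
  have k: "?k \<in> Ar ?C" "Dom ?C ?k = Z" "Cod ?C ?k = Prod ?C ?W ?W"
    using arr dom cod by simp_all
  note \<delta>_simps = \<delta> [unfolded fibered_equality_def Let_def]
  have "reindex P (Pr1 ?C ?W ?W) \<alpha> \<sqinter>\<^bsub>fibre P (Prod ?C ?W ?W)\<^esub> \<delta> ?W
      \<sqsubseteq>\<^bsub>fibre P (Prod ?C ?W ?W)\<^esub> reindex P (Pr2 ?C ?W ?W) \<alpha>"
    using \<delta>_simps ob \<alpha> by simp
  from reindex_le [OF k this]
  have subst: "reindex P \<langle>x, a\<rangle>\<^bsub>?C\<^esub> \<alpha> \<sqinter>\<^bsub>fibre P Z\<^esub> reindex P ?k (\<delta> ?W)
      \<sqsubseteq>\<^bsub>fibre P Z\<^esub> reindex P \<langle>x, b\<rangle>\<^bsub>?C\<^esub> \<alpha>"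
    using \<delta> ob arr dom cod \<alpha> by simp
  let ?pr1 = "Pr1 ?C ?W ?W" and ?pr2 = "Pr2 ?C ?W ?W"
  let ?xx = "\<langle>Pr1 ?C X A \<cdot>\<^bsub>?C\<^esub> ?pr1, Pr1 ?C X A \<cdot>\<^bsub>?C\<^esub> ?pr2\<rangle>\<^bsub>?C\<^esub>"
    and ?ab = "\<langle>Pr2 ?C X A \<cdot>\<^bsub>?C\<^esub> ?pr1, Pr2 ?C X A \<cdot>\<^bsub>?C\<^esub> ?pr2\<rangle>\<^bsub>?C\<^esub>"
  \<comment> \<open>\<open>?xx\<close> and \<open>?ab\<close> select the first and the second
    coordinates of the two copies of X \<times> A; composed with \<open>?k\<close> they become the
    pairs (x, x) and (a, b).\<close>
  have "reindex P ?xx (\<delta> X) \<sqinter>\<^bsub>fibre P (Prod ?C ?W ?W)\<^esub> reindex P ?ab (\<delta> A)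
      \<sqsubseteq>\<^bsub>fibre P (Prod ?C ?W ?W)\<^esub> \<delta> ?W"
    using \<delta>_simps ob by simp
  from reindex_le [OF k this]
  have prod: "reindex P \<langle>x, x\<rangle>\<^bsub>?C\<^esub> (\<delta> X) \<sqinter>\<^bsub>fibre P Z\<^esub> reindex P \<langle>a, b\<rangle>\<^bsub>?C\<^esub> (\<delta> A)
      \<sqsubseteq>\<^bsub>fibre P Z\<^esub> reindex P ?k (\<delta> ?W)"
    using \<delta> ob arr dom cod by simp
  let ?\<alpha>a = "reindex P \<langle>x, a\<rangle>\<^bsub>?C\<^esub> \<alpha>" and ?\<delta>ab = "reindex P \<langle>a, b\<rangle>\<^bsub>?C\<^esub> (\<delta> A)"
    and ?\<delta>xx = "reindex P \<langle>x, x\<rangle>\<^bsub>?C\<^esub> (\<delta> X)" and ?\<delta>k = "reindex P ?k (\<delta> ?W)"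
  have carr: "?\<alpha>a \<in> carrier (fibre P Z)" "?\<delta>ab \<in> carrier (fibre P Z)"
    "?\<delta>xx \<in> carrier (fibre P Z)" "?\<delta>k \<in> carrier (fibre P Z)"
    "reindex P \<langle>x, b\<rangle>\<^bsub>?C\<^esub> \<alpha> \<in> carrier (fibre P Z)"
    using \<delta> arr dom cod ob \<alpha> by simp_all
  \<comment> \<open>By reflexivity x = x holds under any hypothesis, so \<open>?\<delta>ab\<close>
    alone implies the equality \<open>?\<delta>k\<close> of the two pairs.\<close>
  have "?\<delta>ab \<sqsubseteq>\<^bsub>fibre P Z\<^esub> ?\<delta>xx"
    using fibered_equality_refl [OF \<delta> arr(1) dom(1) cod(1)] carr by simp
  then have "?\<delta>ab \<sqsubseteq>\<^bsub>fibre P Z\<^esub> ?\<delta>xx \<sqinter>\<^bsub>fibre P Z\<^esub> ?\<delta>ab"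
    using carr by (intro L.meet_le) simp_all
  then have "?\<delta>ab \<sqsubseteq>\<^bsub>fibre P Z\<^esub> ?\<delta>k"
    using prod by (rule L.le_trans) (use carr in simp_all)
  then have "?\<alpha>a \<sqinter>\<^bsub>fibre P Z\<^esub> ?\<delta>ab \<sqsubseteq>\<^bsub>fibre P Z\<^esub> ?\<delta>k"
    using carr by (intro L.le_trans [OF L.meet_right]) simp_all
  then have "?\<alpha>a \<sqinter>\<^bsub>fibre P Z\<^esub> ?\<delta>ab \<sqsubseteq>\<^bsub>fibre P Z\<^esub> ?\<alpha>a \<sqinter>\<^bsub>fibre P Z\<^esub> ?\<delta>k"
    using carr by (intro L.meet_le L.meet_left) simp_all
  then show ?thesis
    using subst by (rule L.le_trans) (use carr in simp_all)
qed

text \<open>Substitute along \<open>\<delta>\<close> in \<open>\<epsilon>(a, -)\<close>, starting from \<open>\<epsilon>(a, a) = \<top>\<close>.\<close>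

lemma fibered_equality_le:
  assumes \<delta>: "fibered_equality P \<delta>" and \<epsilon>: "fibered_equality P \<epsilon>" and A: "A \<in> Ob (base P)"
  shows "\<delta> A \<sqsubseteq>\<^bsub>fibre P (Prod (base P) A A)\<^esub> \<epsilon> A"
proof -
  let ?C = "base P"
  let ?p = "Pr1 ?C A A" and ?q = "Pr2 ?C A A" and ?L = "fibre P (Prod ?C A A)"
  interpret L: lower_semilattice ?L
    by (rule fibre_meets) (simp add: A)
  have carr: "\<delta> A \<in> carrier ?L" "\<epsilon> A \<in> carrier ?L"
    using \<delta> \<epsilon> A by (auto intro: fibered_equality_closed)
  have "reindex P \<langle>?p, ?p\<rangle>\<^bsub>?C\<^esub> (\<epsilon> A) \<sqinter>\<^bsub>?L\<^esub> reindex P \<langle>?p, ?q\<rangle>\<^bsub>?C\<^esub> (\<delta> A)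
      \<sqsubseteq>\<^bsub>?L\<^esub> reindex P \<langle>?p, ?q\<rangle>\<^bsub>?C\<^esub> (\<epsilon> A)"
    using carr A by (intro fibered_equality_subst [OF \<delta>]) simp_all
  \<comment> \<open>The pair of \<open>?p\<close> and \<open>?q\<close> is the identity of A
    \<times> A, so reindexing along it disappears on both sides.\<close>
  then have le: "reindex P \<langle>?p, ?p\<rangle>\<^bsub>?C\<^esub> (\<epsilon> A) \<sqinter>\<^bsub>?L\<^esub> \<delta> A \<sqsubseteq>\<^bsub>?L\<^esub> \<epsilon> A"
    using carr A by (simp add: reindex_ident)
  have "\<delta> A \<sqsubseteq>\<^bsub>?L\<^esub> reindex P \<langle>?p, ?p\<rangle>\<^bsub>?C\<^esub> (\<epsilon> A)"
    using carr A by (intro fibered_equality_refl [OF \<epsilon>]) simp_all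
  then have "\<delta> A \<sqsubseteq>\<^bsub>?L\<^esub> reindex P \<langle>?p, ?p\<rangle>\<^bsub>?C\<^esub> (\<epsilon> A) \<sqinter>\<^bsub>?L\<^esub> \<delta> A"
    using carr A by (intro L.meet_le) simp_all
  then show ?thesis
    using le by (rule L.le_trans) (use carr A in simp_all)
qed

lemma fibered_equality_unique:
  assumes "fibered_equality P \<delta>" "fibered_equality P \<epsilon>" "A \<in> Ob (base P)"
  shows "\<delta> A = \<epsilon> A"
proof -
  interpret L: lower_semilattice "fibre P (Prod (base P) A A)"
    by (rule fibre_meets) (simp add: assms)
  show ?thesis
    using fibered_equality_le fibered_equality_closed assms by (intro L.le_antisym) simp_all
qed

end


section \<open>The Kleisli doctrine and its canonical arrow\<close>

locale kleisli_base = fp_category C for C :: "('o, 'a) fp_category" (structure) +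
  fixes X :: 'o
  assumes X_in [simp]: "X \<in> Ob C"
begin

abbreviation K where "K \<equiv> kleisli_category C X"

lemma kleisli_simps [simp]:
  "Ob K = Ob C"
  "(A, g) \<in> Ar K \<longleftrightarrow> A \<in> Ob C \<and> g \<in> Ar C \<and> Dom C g = Prod C X A"
  "Dom K (A, g) = A"
  "Cod K (A, g) = Cod C g"
  "Ident K A = (A, Pr2 C X A)"
  "(B, h) \<cdot>\<^bsub>K\<^esub> (A, g) = (A, h \<cdot> \<langle>Pr1 C X A, g\<rangle>)"
  "One K = One C"
  "Prod K A B = Prod C A B"
  "A \<in> Ob C \<Longrightarrow> B \<in> Ob C \<Longrightarrow>
    Pr1 K A B = (Prod C A B, Pr1 C A B \<cdot> Pr2 C X (Prod C A B))"
  "A \<in> Ob C \<Longrightarrow> B \<in> Ob C \<Longrightarrow>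
    Pr2 K A B = (Prod C A B, Pr2 C A B \<cdot> Pr2 C X (Prod C A B))"
  by (simp_all add: kleisli_category_def kleisli_functor_ar_def)

lemma kleisli_Hom_iff [simp]:
  "(A', g) \<in> Hom K A B \<longleftrightarrow>
    A' = A \<and> A \<in> Ob C \<and> g \<in> Ar C \<and> Dom C g = Prod C X A \<and> Cod C g = B"
  by (auto simp: Hom_def)

lemma kleisli_HomE:
  assumes "f \<in> Hom K A B"
  obtains g where "f = (A, g)" "A \<in> Ob C" "g \<in> Ar C" "Dom C g = Prod C X A" "Cod C g = B"
  using assms by (cases f) auto

text \<open>Composition precomposes with a pair (pr1, g). The unit laws are then (pr1, pr2) = id and
  the second projection of a pair; associativity holds because (pr1, h) after (pr1, g) is pr1 paired
  with the Kleisli composite.\<close>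

lemma category_kleisli: "category K"
proof
  show "Dom K f \<in> Ob K" if "f \<in> Ar K" for f
    using that by (cases f) simp
  show "Cod K f \<in> Ob K" if "f \<in> Ar K" for f
    using that by (cases f) simp
  show "Ident K A \<in> Hom K A A" if "A \<in> Ob K" for A
    using that by simp
  show "g \<cdot>\<^bsub>K\<^esub> f \<in> Hom K A D" if "f \<in> Hom K A B" "g \<in> Hom K B D" for f g A B D
    using that by (auto elim!: kleisli_HomE)
  show "f \<cdot>\<^bsub>K\<^esub> Ident K A = f" if "f \<in> Hom K A B" for f A B
    using that by (auto elim!: kleisli_HomE)
  show "Ident K B \<cdot>\<^bsub>K\<^esub> f = f" if "f \<in> Hom K A B" for f A B
    using that by (auto elim!: kleisli_HomE)
  show "h \<cdot>\<^bsub>K\<^esub> (g \<cdot>\<^bsub>K\<^esub> f) = h \<cdot>\<^bsub>K\<^esub> g \<cdot>\<^bsub>K\<^esub> f"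
    if "f \<in> Hom K A B" "g \<in> Hom K B D" "h \<in> Hom K D E" for f g h A B D E
    using that by (auto elim!: kleisli_HomE)
qed

text \<open>Kleisli arrows from \<open>A\<close> to \<open>One C\<close> are the arrows of
  \<open>C\<close> from X \<times> A to \<open>One C\<close>, tagged with \<open>A\<close>.\<close>

lemma terminal_kleisli: "is_terminal K (One K)"
proof -
  have "\<exists>!f. f \<in> Hom K A (One C)" if A: "A \<in> Ob C" for A
  proof -
    obtain t where t: "t \<in> Hom C (Prod C X A) (One C)"
      and unique: "\<And>u. u \<in> Hom C (Prod C X A) (One C) \<Longrightarrow> u = t"
      using terminal A unfolding is_terminal_def by (metis Prod_in X_in)
    show ?thesis
    proof (rule ex1I)
      show "(A, t) \<in> Hom K A (One C)"
        using t A by simp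
      show "f = (A, t)" if "f \<in> Hom K A (One C)" for f
        using that unique by (auto elim!: kleisli_HomE)
    qed
  qed
  then show ?thesis
    using terminal by (simp add: is_terminal_def)
qed

text \<open>Kleisli composition with a projection of \<open>K\<close> is ordinary composition with
  that projection of \<open>C\<close>, so the universal property at \<open>Z\<close> is that of
  \<open>C\<close> at X \<times> Z.\<close>

lemma product_kleisli:
  assumes A: "A \<in> Ob C" and B: "B \<in> Ob C"
  shows "is_product K A B (Prod K A B) (Pr1 K A B) (Pr2 K A B)"
  unfolding is_product_def
proof (intro conjI ballI)
  show "Pr1 K A B \<in> Hom K (Prod K A B) A" "Pr2 K A B \<in> Hom K (Prod K A B) B"
    using A B by simp_all
  fix Z f g
  assume "f \<in> Hom K Z A" "g \<in> Hom K Z B"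
  then obtain f' g' where f: "f = (Z, f')" "f' \<in> Ar C" "Dom C f' = Prod C X Z" "Cod C f' = A"
    and g: "g = (Z, g')" "g' \<in> Ar C" "Dom C g' = Prod C X Z" "Cod C g' = B"
    and Z: "Z \<in> Ob C"
    by (elim kleisli_HomE) blast
  show "\<exists>!h. h \<in> Hom K Z (Prod K A B) \<and> Pr1 K A B \<cdot>\<^bsub>K\<^esub> h = f \<and> Pr2 K A B \<cdot>\<^bsub>K\<^esub> h = g"
  proof (rule ex1I)
    show "(Z, \<langle>f', g'\<rangle>) \<in> Hom K Z (Prod K A B) \<and>
        Pr1 K A B \<cdot>\<^bsub>K\<^esub> (Z, \<langle>f', g'\<rangle>) = f \<and> Pr2 K A B \<cdot>\<^bsub>K\<^esub> (Z, \<langle>f', g'\<rangle>) = g"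
      using A B Z f g by simp
    fix h
    assume h: "h \<in> Hom K Z (Prod K A B) \<and> Pr1 K A B \<cdot>\<^bsub>K\<^esub> h = f \<and> Pr2 K A B \<cdot>\<^bsub>K\<^esub> h = g"
    then obtain h' where h': "h = (Z, h')" "h' \<in> Ar C" "Dom C h' = Prod C X Z"
        "Cod C h' = Prod C A B"
      by (auto elim: kleisli_HomE)
    then have "Pr1 C A B \<cdot> h' = f'" "Pr2 C A B \<cdot> h' = g'"
      using h A B Z f g by simp_all
    then show "h = (Z, \<langle>f', g'\<rangle>)"
      using h' pair_unique [of h' A B] A B by simp
  qed
qed

sublocale kleisli: fp_category K
  using category_kleisli terminal_kleisli product_kleisli
  by (intro fp_category.intro fp_category_axioms.intro) simp_all

text \<open>The untagged pair has the required components in \<open>K\<close>, so uniqueness there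
  identifies it with the pairing of \<open>K\<close>.\<close>

lemma kleisli_pair [simp]:
  assumes "A \<in> Ob C" "g \<in> Ar C" "h \<in> Ar C" "Dom C g = Prod C X A" "Dom C h = Prod C X A"
  shows "\<langle>(A, g), (A, h)\<rangle>\<^bsub>K\<^esub> = (A, \<langle>g, h\<rangle>)"
  using kleisli.pair_unique [of "(A, \<langle>g, h\<rangle>)" "Cod C g" "Cod C h"] assms by simp

text \<open>Products are preserved strictly: the projections of \<open>K\<close> are by construction
  the images of those of \<open>C\<close>.\<close>

lemma fp_functor_kleisli: "fp_functor C K (\<lambda>A. A) (kleisli_functor_ar C X)"
proof
  show "is_terminal K (One C)"
    using terminal_kleisli by simp
  show "is_product K A B (Prod C A B) (kleisli_functor_ar C X (Pr1 C A B))
      (kleisli_functor_ar C X (Pr2 C A B))" if "A \<in> Ob C" "B \<in> Ob C" for A B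
    using product_kleisli [OF that] that by (simp add: kleisli_functor_ar_def)
qed (auto simp: kleisli_functor_ar_def)

end

section \<open>The Kleisli doctrine is primary\<close>

locale kleisli = primary_doctrine P for P :: "('o, 'a, 'p) doctrine" +
  fixes X :: 'o and \<phi> :: 'p
  assumes X_in: "X \<in> Ob (base P)"
    and \<phi>_in [simp]: "\<phi> \<in> carrier (fibre P X)"

sublocale kleisli \<subseteq> kleisli_base "base P" X
  by unfold_locales (rule X_in)

context kleisli
begin

abbreviation KP where "KP \<equiv> kleisli_doctrine P X \<phi>"
abbreviation \<Phi> where "\<Phi> A \<equiv> reindex P (Pr1 (base P) X A) \<phi>"

lemma base_KP [simp]: "base KP = K"
  by (simp add: kleisli_doctrine_def Let_def)

lemma fibre_KP:
  "fibre KP A = fibre P (Prod (base P) X A)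
    \<lparr>carrier := {\<alpha> \<in> carrier (fibre P (Prod (base P) X A)).
      \<alpha> \<sqsubseteq>\<^bsub>fibre P (Prod (base P) X A)\<^esub> \<Phi> A}\<rparr>"
  by (simp add: kleisli_doctrine_def Let_def)

lemma carrier_KP [simp]:
  "\<alpha> \<in> carrier (fibre KP A) \<longleftrightarrow> \<alpha> \<in> carrier (fibre P (Prod (base P) X A)) \<and>
    \<alpha> \<sqsubseteq>\<^bsub>fibre P (Prod (base P) X A)\<^esub> \<Phi> A"
  by (simp add: fibre_KP)

lemma le_KP [simp]: "le (fibre KP A) = le (fibre P (Prod (base P) X A))"
  by (simp add: fibre_KP)

lemma reindex_KP [simp]: "reindex KP (A, g) = reindex P \<langle>Pr1 (base P) X A, g\<rangle>\<^bsub>base P\<^esub>"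
  by (simp add: kleisli_doctrine_def Let_def)

lemma fibre_semilattice: "A \<in> Ob (base P) \<Longrightarrow> lower_semilattice (fibre P (Prod (base P) X A))"
  by (rule fibre_meets) simp

lemma semilattice_KP: "A \<in> Ob (base P) \<Longrightarrow> lower_semilattice (fibre KP A)"
  unfolding fibre_KP by (rule lower_semilattice.principal_down_set [OF fibre_semilattice]) simp_all

lemma top_exists_KP: "A \<in> Ob (base P) \<Longrightarrow> weak_partial_order_top (fibre KP A)"
  unfolding fibre_KP by (rule lower_semilattice.principal_down_set [OF fibre_semilattice]) simp_all

lemma top_KP [simp]: "A \<in> Ob (base P) \<Longrightarrow> \<top>\<^bsub>fibre KP A\<^esub> = \<Phi> A"
  unfolding fibre_KP by (rule lower_semilattice.principal_down_set [OF fibre_semilattice]) simp_all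

lemma meet_KP [simp]:
  "A \<in> Ob (base P) \<Longrightarrow> \<alpha> \<in> carrier (fibre KP A) \<Longrightarrow> \<beta> \<in> carrier (fibre KP A) \<Longrightarrow>
    \<alpha> \<sqinter>\<^bsub>fibre KP A\<^esub> \<beta> = \<alpha> \<sqinter>\<^bsub>fibre P (Prod (base P) X A)\<^esub> \<beta>"
  unfolding fibre_KP
  by (rule lower_semilattice.principal_down_set [OF fibre_semilattice]) simp_all

text \<open>The pair (pr1, g) followed by pr1 is pr1, so reindexing along it sends the bound
  \<open>\<Phi> B\<close> exactly to \<open>\<Phi> A\<close>; monotonicity does the rest.\<close>

lemma reindex_KP_in:
  assumes "f \<in> Hom K A B" "\<alpha> \<in> carrier (fibre KP B)"
  shows "reindex KP f \<alpha> \<in> carrier (fibre KP A)"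
proof -
  obtain g where f: "f = (A, g)" "A \<in> Ob (base P)" "g \<in> Ar (base P)"
      "Dom (base P) g = Prod (base P) X A" "Cod (base P) g = B"
    using assms(1) by (rule kleisli_HomE)
  let ?k = "\<langle>Pr1 (base P) X A, g\<rangle>\<^bsub>base P\<^esub>"
  have B: "B \<in> Ob (base P)"
    using f by auto
  have "reindex P ?k \<alpha> \<sqsubseteq>\<^bsub>fibre P (Prod (base P) X A)\<^esub> reindex P ?k (\<Phi> B)"
    using assms(2) f B by (intro reindex_le [where B = "Prod (base P) X B"]) simp_all
  then show ?thesis
    using assms(2) f B by simp
qed

lemma primary_KP: "primary_doctrine KP"
proof (intro primary_doctrine.intro doctrine.intro primary_doctrine_axioms.intro)
  show "fp_category (base KP)"
    using kleisli.fp_category_axioms by simp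
next
  fix A
  assume "A \<in> Ob (base KP)"
  then have A: "A \<in> Ob (base P)"
    by simp
  show "lower_semilattice (fibre KP A)" "weak_partial_order_top (fibre KP A)"
    using A by (rule semilattice_KP, rule top_exists_KP)
  then show "partial_order (fibre KP A)"
    by (simp add: lower_semilattice_def)
  show "reindex KP (Ident (base KP) A) \<alpha> = \<alpha>" if "\<alpha> \<in> carrier (fibre KP A)" for \<alpha>
    using that A by (simp add: reindex_ident)
next
  fix f A B
  assume "f \<in> Hom (base KP) A B"
  then have f: "f \<in> Hom K A B"
    by simp
  then show "reindex KP f \<in> carrier (fibre KP B) \<rightarrow> carrier (fibre KP A)"
    using reindex_KP_in by blast
  obtain g where g: "f = (A, g)" "A \<in> Ob (base P)" "g \<in> Ar (base P)"
      "Dom (base P) g = Prod (base P) X A" "Cod (base P) g = B"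
    using f by (rule kleisli_HomE)
  then have B: "B \<in> Ob (base P)"
    by auto
  show "isotone (fibre KP B) (fibre KP A) (reindex KP f)"
  proof
    show "weak_partial_order (fibre KP B)" "weak_partial_order (fibre KP A)"
      using semilattice_KP g(2) B lower_semilattice.axioms(1) partial_order.axioms(1) by blast+
    show "reindex KP f \<alpha> \<sqsubseteq>\<^bsub>fibre KP A\<^esub> reindex KP f \<beta>"
      if "\<alpha> \<in> carrier (fibre KP B)" "\<beta> \<in> carrier (fibre KP B)" "\<alpha> \<sqsubseteq>\<^bsub>fibre KP B\<^esub> \<beta>" for \<alpha> \<beta>
      using that g B by (auto intro: reindex_le [where B = "Prod (base P) X B"])
  qed
  show "preserves_finite_meets (fibre KP B) (fibre KP A) (reindex KP f)"
    unfolding preserves_finite_meets_def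
  proof (intro conjI ballI)
    \<comment> \<open>The tops are the bounds \<open>\<Phi> B\<close> and \<open>\<Phi> A\<close>,
      which correspond under reindexing because the pair (pr1, g) leaves the coordinate in
      \<open>X\<close> alone.\<close>
    show "reindex KP f \<top>\<^bsub>fibre KP B\<^esub> = \<top>\<^bsub>fibre KP A\<^esub>"
      using g B by simp
    fix \<alpha> \<beta>
    assume \<alpha>\<beta>: "\<alpha> \<in> carrier (fibre KP B)" "\<beta> \<in> carrier (fibre KP B)"
    show "reindex KP f (\<alpha> \<sqinter>\<^bsub>fibre KP B\<^esub> \<beta>) = reindex KP f \<alpha> \<sqinter>\<^bsub>fibre KP A\<^esub> reindex KP f \<beta>"
      using reindex_KP_in [OF f \<alpha>\<beta>(1)] reindex_KP_in [OF f \<alpha>\<beta>(2)] \<alpha>\<beta> g B by simp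
  qed
  fix h D \<gamma>
  assume h: "h \<in> Hom (base KP) B D" and \<gamma>: "\<gamma> \<in> carrier (fibre KP D)"
  from h obtain k where "h = (B, k)" "k \<in> Ar (base P)" "Dom (base P) k = Prod (base P) X B"
      "Cod (base P) k = D"
    unfolding base_KP by (rule kleisli_HomE)
  \<comment> \<open>Functoriality of \<open>P\<close> applies since (pr1, k) after (pr1, g) is pr1
    paired with the Kleisli composite.\<close>
  then show "reindex KP (h \<cdot>\<^bsub>base KP\<^esub> f) \<gamma> = reindex KP f (reindex KP h \<gamma>)"
    using \<gamma> g B by auto
qed

section \<open>The canonical arrow is a primary homomorphism\<close>

abbreviation H where "H \<equiv> kleisli_arrow P X \<phi>"

lemma kleisli_arrow_simps [simp]:
  "on_ob H A = A"
  "on_ar H = kleisli_functor_ar (base P) X"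
  "on_fibre H A \<alpha> =
    \<Phi> A \<sqinter>\<^bsub>fibre P (Prod (base P) X A)\<^esub> reindex P (Pr2 (base P) X A) \<alpha>"
  by (simp_all add: kleisli_arrow_def Let_def)

lemma on_fibre_closed:
  assumes "A \<in> Ob (base P)" "\<alpha> \<in> carrier (fibre P A)"
  shows "on_fibre H A \<alpha> \<in> carrier (fibre KP A)"
proof -
  interpret L: lower_semilattice "fibre P (Prod (base P) X A)"
    by (rule fibre_semilattice) fact
  show ?thesis
    using assms by (auto intro: L.meet_left)
qed

lemma on_fibre_le:
  assumes "A \<in> Ob (base P)" "\<alpha> \<in> carrier (fibre P A)" "\<beta> \<in> carrier (fibre P A)"
    "\<alpha> \<sqsubseteq>\<^bsub>fibre P A\<^esub> \<beta>"
  shows "on_fibre H A \<alpha> \<sqsubseteq>\<^bsub>fibre KP A\<^esub> on_fibre H A \<beta>"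
proof -
  interpret L: lower_semilattice "fibre P (Prod (base P) X A)"
    by (rule fibre_semilattice) fact
  have "reindex P (Pr2 (base P) X A) \<alpha> \<sqsubseteq>\<^bsub>fibre P (Prod (base P) X A)\<^esub>
      reindex P (Pr2 (base P) X A) \<beta>"
    using assms by (intro reindex_le [where B = A]) simp_all
  then show ?thesis
    using assms
    by (auto intro!: L.meet_le L.meet_left L.le_trans [OF L.meet_right])
qed

lemma on_fibre_meet:
  assumes "A \<in> Ob (base P)" "\<alpha> \<in> carrier (fibre P A)" "\<beta> \<in> carrier (fibre P A)"
  shows "on_fibre H A (\<alpha> \<sqinter>\<^bsub>fibre P A\<^esub> \<beta>) = on_fibre H A \<alpha> \<sqinter>\<^bsub>fibre KP A\<^esub> on_fibre H A \<beta>"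
proof -
  let ?L = "fibre P (Prod (base P) X A)"
  interpret L: lower_semilattice ?L
    by (rule fibre_semilattice) fact
  have "on_fibre H A \<alpha> \<sqinter>\<^bsub>fibre KP A\<^esub> on_fibre H A \<beta> = on_fibre H A \<alpha> \<sqinter>\<^bsub>?L\<^esub> on_fibre H A \<beta>"
    using assms on_fibre_closed by (intro meet_KP)
  then show ?thesis
    using assms by (simp add: L.meet_distrib_meet [symmetric])
qed

text \<open>Meeting with \<top> leaves \<open>\<Phi> A\<close>, which is the top of the Kleisli
  fibre although in general not of the ambient fibre of \<open>P\<close>.\<close>

lemma on_fibre_top:
  assumes "A \<in> Ob (base P)"
  shows "on_fibre H A \<top>\<^bsub>fibre P A\<^esub> = \<top>\<^bsub>fibre KP A\<^esub>"
proof -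
  let ?L = "fibre P (Prod (base P) X A)"
  interpret L: lower_semilattice ?L
    by (rule fibre_semilattice) fact
  interpret T: weak_partial_order_top ?L
    by (rule fibre_top) (simp add: assms)
  have "\<Phi> A \<sqinter>\<^bsub>?L\<^esub> \<top>\<^bsub>?L\<^esub> = \<Phi> A"
    using assms by (intro L.le_antisym L.meet_le L.meet_left) simp_all
  then show ?thesis
    using assms by simp
qed

text \<open>The image of \<open>f\<close> acts through the pair (pr1, f pr2), whose components are
  pr1 and f pr2. Both sides therefore become \<open>\<Phi> A\<close> met with \<beta> reindexed
  along f pr2.\<close>

lemma natural_kleisli_arrow:
  assumes "f \<in> Hom (base P) A B" "\<beta> \<in> carrier (fibre P B)"
  shows "on_fibre H A (reindex P f \<beta>) = reindex KP (on_ar H f) (on_fibre H B \<beta>)"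
  using assms base.dom_in [of f] base.cod_in [of f] by (auto simp: kleisli_functor_ar_def)

lemma primary_hom_kleisli_arrow: "primary_hom P KP H"
proof -
  interpret KP: primary_doctrine KP
    by (rule primary_KP)
  show ?thesis
  proof (intro primary_hom.intro doctrine_hom.intro primary_hom_axioms.intro)
    show "doctrine P" "doctrine KP" "primary_doctrine P" "primary_doctrine KP"
      by unfold_locales
    show "fp_functor (base P) (base KP) (on_ob H) (on_ar H)"
      using fp_functor_kleisli by (simp add: kleisli_arrow_def Let_def)
    show "on_fibre H A (reindex P f \<beta>) = reindex KP (on_ar H f) (on_fibre H B \<beta>)"
      if "f \<in> Hom (base P) A B" "\<beta> \<in> carrier (fibre P B)" for f A B \<beta>
      using natural_kleisli_arrow that .
  next
    fix A
    assume A: "A \<in> Ob (base P)"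
    show "on_fibre H A \<in> carrier (fibre P A) \<rightarrow> carrier (fibre KP (on_ob H A))"
      using on_fibre_closed [OF A] by (simp del: carrier_KP kleisli_arrow_simps(3))
    show "isotone (fibre P A) (fibre KP (on_ob H A)) (on_fibre H A)"
      using A fibre_poset [of A] KP.fibre_poset [of A] on_fibre_le [OF A]
      by (intro isotoneI) (simp_all del: kleisli_arrow_simps(3) le_KP add: partial_order.axioms(1))
    show "preserves_finite_meets (fibre P A) (fibre KP (on_ob H A)) (on_fibre H A)"
      using on_fibre_top [OF A] on_fibre_meet [OF A]
      by (simp del: kleisli_arrow_simps(3) add: preserves_finite_meets_def)
  qed
qed

section \<open>Fibered equality in the Kleisli doctrine\<close>

lemma fibered_equality_KP:
  assumes \<delta>: "fibered_equality P \<delta>"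
  shows "fibered_equality KP (\<lambda>A. on_fibre H (Prod (base P) A A) (\<delta> A))"
proof -
  let ?C = "base P"
  let ?\<delta>' = "\<lambda>A. on_fibre H (Prod ?C A A) (\<delta> A)"
  let ?F = "kleisli_functor_ar ?C X"
  note \<delta>_in = fibered_equality_closed [OF \<delta>]
  have \<delta>'_in: "?\<delta>' A \<in> carrier (fibre KP (Prod ?C A A))" if "A \<in> Ob ?C" for A
    using that \<delta>_in by (intro on_fibre_closed) simp_all
  have reflexive: "\<top>\<^bsub>fibre KP A\<^esub> \<sqsubseteq>\<^bsub>fibre KP A\<^esub> reindex KP \<langle>Ident K A, Ident K A\<rangle>\<^bsub>K\<^esub> (?\<delta>' A)"
    if A: "A \<in> Ob ?C" for A
  proof -
    let ?\<Delta> = "\<langle>Ident ?C A, Ident ?C A\<rangle>\<^bsub>?C\<^esub>"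
    have "\<top>\<^bsub>fibre P A\<^esub> \<sqsubseteq>\<^bsub>fibre P A\<^esub> reindex P ?\<Delta> (\<delta> A)"
      using \<delta> A by (simp add: fibered_equality_def Let_def)
    then have "on_fibre H A \<top>\<^bsub>fibre P A\<^esub> \<sqsubseteq>\<^bsub>fibre KP A\<^esub> on_fibre H A (reindex P ?\<Delta> (\<delta> A))"
      using A \<delta>_in by (intro on_fibre_le) simp_all
    \<comment> \<open>Naturality moves \<ff> inside the reindexing; the functor then carries the
      diagonal of \<open>A\<close> to the diagonal in \<open>K\<close>.\<close>
    also have "on_fibre H A (reindex P ?\<Delta> (\<delta> A)) = reindex KP (?F ?\<Delta>) (?\<delta>' A)"
      using A \<delta>_in natural_kleisli_arrow [of ?\<Delta> A "Prod ?C A A" "\<delta> A"]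
      by (simp del: kleisli_arrow_simps(3))
    also have "?F ?\<Delta> = \<langle>Ident K A, Ident K A\<rangle>\<^bsub>K\<^esub>"
      using A by (simp add: kleisli_functor_ar_def)
    finally show ?thesis
      using on_fibre_top [OF A] by simp
  qed
  have subst: "reindex KP (Pr1 K A A) \<alpha> \<sqinter>\<^bsub>fibre KP (Prod K A A)\<^esub> ?\<delta>' A
      \<sqsubseteq>\<^bsub>fibre KP (Prod K A A)\<^esub> reindex KP (Pr2 K A A) \<alpha>"
    if A: "A \<in> Ob ?C" and \<alpha>: "\<alpha> \<in> carrier (fibre KP A)" for A \<alpha>
  proof -
    let ?AA = "Prod ?C A A"
    let ?L = "fibre P (Prod ?C X ?AA)"
    let ?x = "Pr1 ?C X ?AA" and ?r = "Pr2 ?C X ?AA"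
    let ?a = "Pr1 ?C A A \<cdot>\<^bsub>?C\<^esub> ?r" and ?b = "Pr2 ?C A A \<cdot>\<^bsub>?C\<^esub> ?r"
    interpret L: lower_semilattice ?L
      by (rule fibre_semilattice) (simp add: A)
    \<comment> \<open>A Kleisli predicate \<alpha> on \<open>A\<close> lives over X \<times> A. In
      the context X \<times> (A \<times> A) its two reindexings share the parameter
      \<open>?x\<close> and differ only in \<open>?a\<close> and \<open>?b\<close>.\<close>
    have "reindex P \<langle>?x, ?a\<rangle>\<^bsub>?C\<^esub> \<alpha> \<sqinter>\<^bsub>?L\<^esub> reindex P \<langle>?a, ?b\<rangle>\<^bsub>?C\<^esub> (\<delta> A)
        \<sqsubseteq>\<^bsub>?L\<^esub> reindex P \<langle>?x, ?b\<rangle>\<^bsub>?C\<^esub> \<alpha>"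
      using A \<alpha> by (intro fibered_equality_subst [OF \<delta>, where X = X]) simp_all
    moreover have "\<langle>?a, ?b\<rangle>\<^bsub>?C\<^esub> = ?r"
      using A by (intro base.pair_unique) simp_all
    ultimately have le: "reindex P \<langle>?x, ?a\<rangle>\<^bsub>?C\<^esub> \<alpha> \<sqinter>\<^bsub>?L\<^esub> reindex P ?r (\<delta> A)
        \<sqsubseteq>\<^bsub>?L\<^esub> reindex P \<langle>?x, ?b\<rangle>\<^bsub>?C\<^esub> \<alpha>"
      by simp
    have carr: "reindex P \<langle>?x, ?a\<rangle>\<^bsub>?C\<^esub> \<alpha> \<in> carrier ?L" "reindex P ?r (\<delta> A) \<in> carrier ?L"
      "reindex P \<langle>?x, ?b\<rangle>\<^bsub>?C\<^esub> \<alpha> \<in> carrier ?L" "\<Phi> ?AA \<in> carrier ?L"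
      using A \<alpha> \<delta>_in by simp_all
    \<comment> \<open>The bound \<open>\<Phi> ?AA\<close> contained in \<open>?\<delta>'\<close>
      only makes the left-hand side smaller.\<close>
    have "reindex P \<langle>?x, ?a\<rangle>\<^bsub>?C\<^esub> \<alpha> \<sqinter>\<^bsub>?L\<^esub> (\<Phi> ?AA \<sqinter>\<^bsub>?L\<^esub> reindex P ?r (\<delta> A))
        \<sqsubseteq>\<^bsub>?L\<^esub> reindex P \<langle>?x, ?a\<rangle>\<^bsub>?C\<^esub> \<alpha> \<sqinter>\<^bsub>?L\<^esub> reindex P ?r (\<delta> A)"
      using carr by (intro L.meet_le L.meet_left L.meet_le_right L.meet_right) simp_all
    then have "reindex P \<langle>?x, ?a\<rangle>\<^bsub>?C\<^esub> \<alpha> \<sqinter>\<^bsub>?L\<^esub> ?\<delta>' A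
        \<sqsubseteq>\<^bsub>?L\<^esub> reindex P \<langle>?x, ?b\<rangle>\<^bsub>?C\<^esub> \<alpha>"
      unfolding kleisli_arrow_simps using le by (rule L.le_trans) (use carr in simp_all)
    moreover have "reindex KP (Pr1 K A A) \<alpha> \<in> carrier (fibre KP ?AA)"
      using A \<alpha> by (intro reindex_KP_in [of _ _ A]) simp_all
    then have "reindex KP (Pr1 K A A) \<alpha> \<sqinter>\<^bsub>fibre KP ?AA\<^esub> ?\<delta>' A
        = reindex KP (Pr1 K A A) \<alpha> \<sqinter>\<^bsub>?L\<^esub> ?\<delta>' A"
      using A \<delta>'_in by (intro meet_KP) simp_all
    ultimately show ?thesis
      using A by simp
  qed
  have prod: "reindex KP \<langle>Pr1 K A B \<cdot>\<^bsub>K\<^esub> Pr1 K AB AB, Pr1 K A B \<cdot>\<^bsub>K\<^esub> Pr2 K AB AB\<rangle>\<^bsub>K\<^esub> (?\<delta>' A)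
      \<sqinter>\<^bsub>fibre KP (Prod K AB AB)\<^esub>
      reindex KP \<langle>Pr2 K A B \<cdot>\<^bsub>K\<^esub> Pr1 K AB AB, Pr2 K A B \<cdot>\<^bsub>K\<^esub> Pr2 K AB AB\<rangle>\<^bsub>K\<^esub> (?\<delta>' B)
      \<sqsubseteq>\<^bsub>fibre KP (Prod K AB AB)\<^esub> ?\<delta>' AB"
    if A: "A \<in> Ob ?C" and B: "B \<in> Ob ?C" and AB: "AB = Prod ?C A B" for A B AB
  proof -
    let ?V = "Prod ?C AB AB"
    let ?k = "\<langle>Pr1 ?C A B \<cdot>\<^bsub>?C\<^esub> Pr1 ?C AB AB, Pr1 ?C A B \<cdot>\<^bsub>?C\<^esub> Pr2 ?C AB AB\<rangle>\<^bsub>?C\<^esub>"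
      and ?l = "\<langle>Pr2 ?C A B \<cdot>\<^bsub>?C\<^esub> Pr1 ?C AB AB, Pr2 ?C A B \<cdot>\<^bsub>?C\<^esub> Pr2 ?C AB AB\<rangle>\<^bsub>?C\<^esub>"
    have kl: "reindex P ?k (\<delta> A) \<in> carrier (fibre P ?V)"
      "reindex P ?l (\<delta> B) \<in> carrier (fibre P ?V)"
      using A B AB \<delta>_in by simp_all
    have "reindex P ?k (\<delta> A) \<sqinter>\<^bsub>fibre P ?V\<^esub> reindex P ?l (\<delta> B) \<sqsubseteq>\<^bsub>fibre P ?V\<^esub> \<delta> AB"
      using \<delta> A B AB by (simp add: fibered_equality_def Let_def)
    \<comment> \<open>Applying \<ff> to the product inequality of \<open>P\<close> suffices: it is
      monotone, preserves the meet and is natural, and the functor takes the projection pairs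
      \<open>?k\<close> and \<open>?l\<close> to those of \<open>K\<close>.\<close>
    then have "on_fibre H ?V (reindex P ?k (\<delta> A) \<sqinter>\<^bsub>fibre P ?V\<^esub> reindex P ?l (\<delta> B))
        \<sqsubseteq>\<^bsub>fibre KP ?V\<^esub> ?\<delta>' AB"
      using A B AB \<delta>_in kl by (intro on_fibre_le) simp_all
    also have "on_fibre H ?V (reindex P ?k (\<delta> A) \<sqinter>\<^bsub>fibre P ?V\<^esub> reindex P ?l (\<delta> B))
        = on_fibre H ?V (reindex P ?k (\<delta> A)) \<sqinter>\<^bsub>fibre KP ?V\<^esub> on_fibre H ?V (reindex P ?l (\<delta> B))"
      using A B AB kl by (intro on_fibre_meet) simp_all
    also have "on_fibre H ?V (reindex P ?k (\<delta> A)) = reindex KP (?F ?k) (?\<delta>' A)"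
      using A B AB \<delta>_in natural_kleisli_arrow [of ?k ?V "Prod ?C A A" "\<delta> A"]
      by (simp del: kleisli_arrow_simps(3))
    also have "on_fibre H ?V (reindex P ?l (\<delta> B)) = reindex KP (?F ?l) (?\<delta>' B)"
      using A B AB \<delta>_in natural_kleisli_arrow [of ?l ?V "Prod ?C B B" "\<delta> B"]
      by (simp del: kleisli_arrow_simps(3))
    also have "?F ?k = \<langle>Pr1 K A B \<cdot>\<^bsub>K\<^esub> Pr1 K AB AB, Pr1 K A B \<cdot>\<^bsub>K\<^esub> Pr2 K AB AB\<rangle>\<^bsub>K\<^esub>"
      using A B AB by (simp add: kleisli_functor_ar_def)
    also have "?F ?l = \<langle>Pr2 K A B \<cdot>\<^bsub>K\<^esub> Pr1 K AB AB, Pr2 K A B \<cdot>\<^bsub>K\<^esub> Pr2 K AB AB\<rangle>\<^bsub>K\<^esub>"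
      using A B AB by (simp add: kleisli_functor_ar_def)
    finally show ?thesis
      by simp
  qed
  show ?thesis
    unfolding fibered_equality_def Let_def base_KP kleisli_simps(1)
  proof (intro conjI ballI)
    show "?\<delta>' A \<in> carrier (fibre KP (Prod K A A))" if "A \<in> Ob ?C" for A
      using \<delta>'_in [OF that] by (simp only: kleisli_simps)
  qed (rule reflexive subst prod; simp only: kleisli_simps)+
qed

lemma elementary_KP:
  assumes "fibered_equality P \<delta>"
  shows "elementary_doctrine KP"
  using primary_KP fibered_equality_KP [OF assms]
  by (auto simp: elementary_doctrine_def elementary_doctrine_axioms_def)

end

theorem proposition5p4:
  fixes P :: "('o, 'a, 'p) doctrine" and X :: 'o and \<phi> :: 'p
  assumes "primary_doctrine P"
    and "X \<in> Ob (base P)"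
    and "\<phi> \<in> carrier (fibre P X)"
    and "elementary_doctrine P"
  shows "elementary_doctrine (kleisli_doctrine P X \<phi>) \<and>
    elementary_hom P (kleisli_doctrine P X \<phi>) (kleisli_arrow P X \<phi>)"
proof -
  interpret primary_doctrine P by fact
  interpret kleisli P X \<phi>
    by unfold_locales fact+
  obtain \<delta> where "fibered_equality P \<delta>"
    using assms(4) elementary_doctrine.ex_fibered_equality by blast
  then have KP: "elementary_doctrine KP"
    by (rule elementary_KP)
  have "on_fibre H (Prod (base P) A A) (\<delta> A) =
      reindex KP \<langle>on_ar H (Pr1 (base P) A A), on_ar H (Pr2 (base P) A A)\<rangle>\<^bsub>base KP\<^esub>
        (\<epsilon> (on_ob H A))"
    if \<delta>: "fibered_equality P \<delta>" and \<epsilon>: "fibered_equality KP \<epsilon>" and A: "A \<in> Ob (base P)"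
    for \<delta> \<epsilon> A
  proof -
    interpret KP: primary_doctrine KP
      by (rule primary_KP)
    \<comment> \<open>Here \<epsilon> is an arbitrary fibered equality of the Kleisli doctrine; the
      image of \<delta> is another, so uniqueness makes them agree.\<close>
    have "on_fibre H (Prod (base P) A A) (\<delta> A) = \<epsilon> A"
      using KP.fibered_equality_unique [OF fibered_equality_KP [OF \<delta>] \<epsilon>] A by simp
    moreover have "\<epsilon> A \<in> carrier (fibre KP (Prod (base P) A A))"
      using KP.fibered_equality_closed [OF \<epsilon>] A by simp
    \<comment> \<open>Since the chosen projections go to the chosen projections, the comparison
      arrow is an identity and reindexing along it fixes \<open>\<epsilon> A\<close>.\<close>
    moreover have "\<langle>on_ar H (Pr1 (base P) A A), on_ar H (Pr2 (base P) A A)\<rangle>\<^bsub>base KP\<^esub>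
        = Ident K (Prod (base P) A A)"
      using kleisli.pair_Pr [of A A] A
      by (simp add: kleisli_functor_ar_def del: kleisli.pair_Pr)
    ultimately show ?thesis
      using A KP.reindex_ident [of "Prod (base P) A A" "\<epsilon> A"]
      by (simp del: kleisli_arrow_simps(3))
  qed
  then show ?thesis
    using KP primary_hom_kleisli_arrow assms(4)
    by (auto simp: elementary_hom_def elementary_hom_axioms_def)
qed

end
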